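(* In the setting of the context, let $q\in(0,1)$ and let $Q\in\mathcal O(\mathcal L^1,q)$, with constant $L$, be a linear operator generated by an infinite real matrix $\{Q_{x,y}\}_{x,y\in\gamma}$ with $Q_{x,y}\ge0$ for all $x,y\in\gamma$. Let $\alpha\in\mathcal A$ and $\bar z=(z_x)_{x\in\gamma}\in l^1_\alpha$ with $z_x\ge0$ for all $x\in\gamma$. Let $g:\mathcal T\to l^1_\alpha$ be a bounded measurable map with $g_x(t)\ge0$ for all $x\in\gamma$, $t\in\mathcal T$, such that $$g_x(t)\le z_x+\Big[\int_0^tQg(s)\,ds\Big]_x,\qquad t\in\mathcal T,\ x\in\gamma.$$ Then for all $\beta\in(\alpha,\alpha^*]$, $$\sum_{x\in\gamma}e^{-\beta|x|}\sup_{t\in\mathcal T}g_x(t)\le K_T(\alpha,\beta)\sum_{x\in\gamma}e^{-\alpha|x|}z_x,\qquad K_T(\alpha,\beta)=\sum_{n=0}^\infty\frac{L^nT^n}{(\beta-\alpha)^{qn}}\frac{n^{qn}}{n!}<\infty .$$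
   Context: $\gamma\subset\mathbb R^d$ is a fixed locally finite set; $\mathcal T=[0,T]$ with $T>0$. Fix $0\le\alpha_*<\alpha^*<\infty$, $\mathcal A=[\alpha_*,\alpha^* )$. For $\alpha\in[\alpha_*,\alpha^*]$, $l^1_\alpha$ is the Banach space of real families $\bar z=(z_x)_{x\in\gamma}$ with $\|\bar z\|_{l^1_\alpha}=\sum_{x\in\gamma}e^{-\alpha|x|}|z_x|<\infty$; $\mathcal L^1=\{l^1_\alpha\}_{\alpha\in\mathcal A}$. A linear operator $Q$ on $\bigcup_{\alpha\in\mathcal A}l^1_\alpha$ belongs to $\mathcal O(\mathcal L^1,q)$ (Ovsjannikov operator of order $q>0$) with constant $L>0$ if $Q(l^1_\alpha)\subset l^1_\beta$ and $\|Qu\|_{l^1_\beta}\le\frac{L}{(\beta-\alpha)^q}\|u\|_{l^1_\alpha}$ for all $u\in l^1_\alpha$ and all $\alpha<\beta$ in $\mathcal A$. $Q$ is generated by the matrix $\{Q_{x,y}\}$ if $(Qu)_x=\sum_{y\in\gamma}Q_{x,y}u_y$. $[\cdot]_x$ denotes the $x$-component. Convention: $0^0=1$. *)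

theory Defs
  imports "HOL-Analysis.Analysis"
begin

definition locally_finite_set :: "(real ^ 'd) set \<Rightarrow> bool" where
  "locally_finite_set \<gamma> \<longleftrightarrow> (\<forall>C. compact C \<longrightarrow> finite (\<gamma> \<inter> C))"

text \<open>
  A family indexed by \<open>\<gamma>\<close> is represented by a function on the whole space that vanishes
  outside \<open>\<gamma>\<close>, so that pointwise equality of functions is equality of families.
\<close>

definition l1 :: "(real ^ 'd) set \<Rightarrow> real \<Rightarrow> (real ^ 'd \<Rightarrow> real) set" where
  "l1 \<gamma> \<alpha> = {z. (\<forall>x. x \<notin> \<gamma> \<longrightarrow> z x = 0) \<and> (\<lambda>x. exp (- \<alpha> * norm x) * \<bar>z x\<bar>) summable_on \<gamma>}"

definition l1_norm :: "(real ^ 'd) set \<Rightarrow> real \<Rightarrow> (real ^ 'd \<Rightarrow> real) \<Rightarrow> real" where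
  "l1_norm \<gamma> \<alpha> z = (\<Sum>\<^sub>\<infinity>x\<in>\<gamma>. exp (- \<alpha> * norm x) * \<bar>z x\<bar>)"

definition l1_dist :: "(real ^ 'd) set \<Rightarrow> real \<Rightarrow> (real ^ 'd \<Rightarrow> real) \<Rightarrow> (real ^ 'd \<Rightarrow> real) \<Rightarrow> real" where
  "l1_dist \<gamma> \<alpha> u v = l1_norm \<gamma> \<alpha> (\<lambda>x. u x - v x)"

lemma Metric_space_l1:
  fixes \<gamma> :: "(real ^ 'd) set"
  shows "Metric_space (l1 \<gamma> \<alpha>) (l1_dist \<gamma> \<alpha>)"
proof
  have diff: "(\<lambda>x. exp (- \<alpha> * norm x) * \<bar>u x - v x\<bar>) summable_on \<gamma>"
    if "u \<in> l1 \<gamma> \<alpha>" "v \<in> l1 \<gamma> \<alpha>" for u v :: "real ^ 'd \<Rightarrow> real"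
  proof (rule summable_on_comparison_test)
    show "(\<lambda>x. exp (- \<alpha> * norm x) * \<bar>u x\<bar> + exp (- \<alpha> * norm x) * \<bar>v x\<bar>) summable_on \<gamma>"
      using that by (intro summable_on_add) (auto simp: l1_def)
    show "exp (- \<alpha> * norm x) * \<bar>u x - v x\<bar>
        \<le> exp (- \<alpha> * norm x) * \<bar>u x\<bar> + exp (- \<alpha> * norm x) * \<bar>v x\<bar>" for x
      unfolding distrib_left[symmetric] by (intro mult_left_mono) auto
  qed auto
  fix u v w :: "real ^ 'd \<Rightarrow> real"
  show "0 \<le> l1_dist \<gamma> \<alpha> u v"
    unfolding l1_dist_def l1_norm_def by (intro infsum_nonneg) auto
  show "l1_dist \<gamma> \<alpha> u v = l1_dist \<gamma> \<alpha> v u"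
    by (simp add: l1_dist_def l1_norm_def abs_minus_commute)
  show "l1_dist \<gamma> \<alpha> u v = 0 \<longleftrightarrow> u = v" if uv: "u \<in> l1 \<gamma> \<alpha>" "v \<in> l1 \<gamma> \<alpha>"
  proof
    assume "l1_dist \<gamma> \<alpha> u v = 0"
    then have "exp (- \<alpha> * norm x) * \<bar>u x - v x\<bar> = 0" if "x \<in> \<gamma>" for x
      using that nonneg_infsum_le_0D[OF _ diff[OF uv], of x]
      by (simp add: l1_dist_def l1_norm_def)
    then have "u x = v x" if "x \<in> \<gamma>" for x
      using that by simp
    moreover have "u x = v x" if "x \<notin> \<gamma>" for x
      using that uv by (simp add: l1_def)
    ultimately show "u = v" by blast
  qed (simp add: l1_dist_def l1_norm_def)
  show "l1_dist \<gamma> \<alpha> u w \<le> l1_dist \<gamma> \<alpha> u v + l1_dist \<gamma> \<alpha> v w"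
    if u: "u \<in> l1 \<gamma> \<alpha>" and v: "v \<in> l1 \<gamma> \<alpha>" and w: "w \<in> l1 \<gamma> \<alpha>"
  proof -
    have "(\<Sum>\<^sub>\<infinity>x\<in>\<gamma>. exp (- \<alpha> * norm x) * \<bar>u x - w x\<bar>)
        \<le> (\<Sum>\<^sub>\<infinity>x\<in>\<gamma>. exp (- \<alpha> * norm x) * \<bar>u x - v x\<bar> + exp (- \<alpha> * norm x) * \<bar>v x - w x\<bar>)"
    proof (rule infsum_mono[OF diff[OF u w] summable_on_add[OF diff[OF u v] diff[OF v w]]])
      show "exp (- \<alpha> * norm x) * \<bar>u x - w x\<bar>
          \<le> exp (- \<alpha> * norm x) * \<bar>u x - v x\<bar> + exp (- \<alpha> * norm x) * \<bar>v x - w x\<bar>" for x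
        unfolding distrib_left[symmetric] by (intro mult_left_mono) auto
    qed
    then show ?thesis
      unfolding l1_dist_def l1_norm_def infsum_add[OF diff[OF u v] diff[OF v w]] .
  qed
qed

definition l1_borel :: "(real ^ 'd) set \<Rightarrow> real \<Rightarrow> (real ^ 'd \<Rightarrow> real) measure" where
  "l1_borel \<gamma> \<alpha> =
     sigma (l1 \<gamma> \<alpha>) {U. openin (Metric_space.mtopology (l1 \<gamma> \<alpha>) (l1_dist \<gamma> \<alpha>)) U}"

text \<open>
  The Bochner integral in \<open>l1 \<gamma> \<alpha>\<close>. It follows the definition of the library integral
  (\<open>has_bochner_integral\<close>), which needs the Banach space to be a type and therefore does not
  apply to the parameter-dependent spaces \<open>l1 \<gamma> \<alpha>\<close>.
\<close>

definition l1_simple :: "(real ^ 'd) set \<Rightarrow> real \<Rightarrow> 'b measure \<Rightarrow> ('b \<Rightarrow> real ^ 'd \<Rightarrow> real) \<Rightarrow> bool" where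
  "l1_simple \<gamma> \<alpha> M s \<longleftrightarrow> simple_function M s \<and> s ` space M \<subseteq> l1 \<gamma> \<alpha> \<and>
     emeasure M {t \<in> space M. s t \<noteq> (\<lambda>_. 0)} \<noteq> \<infinity>"

definition l1_simple_integral :: "'b measure \<Rightarrow> ('b \<Rightarrow> real ^ 'd \<Rightarrow> real) \<Rightarrow> real ^ 'd \<Rightarrow> real" where
  "l1_simple_integral M s = (\<lambda>x. \<Sum>u \<in> s ` space M. measure M {t \<in> space M. s t = u} * u x)"

definition has_l1_integral ::
  "(real ^ 'd) set \<Rightarrow> real \<Rightarrow> 'b measure \<Rightarrow> ('b \<Rightarrow> real ^ 'd \<Rightarrow> real) \<Rightarrow> (real ^ 'd \<Rightarrow> real) \<Rightarrow> bool" where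
  "has_l1_integral \<gamma> \<alpha> M f I \<longleftrightarrow>
     f \<in> measurable M (l1_borel \<gamma> \<alpha>) \<and> I \<in> l1 \<gamma> \<alpha> \<and>
     (\<exists>s. (\<forall>i. l1_simple \<gamma> \<alpha> M (s i)) \<and>
        (\<lambda>i::nat. \<integral>\<^sup>+t. ennreal (l1_dist \<gamma> \<alpha> (f t) (s i t)) \<partial>M) \<longlonglongrightarrow> 0 \<and>
        (\<lambda>i. l1_dist \<gamma> \<alpha> (l1_simple_integral M (s i)) I) \<longlonglongrightarrow> 0)"

definition l1_integral ::
  "(real ^ 'd) set \<Rightarrow> real \<Rightarrow> 'b measure \<Rightarrow> ('b \<Rightarrow> real ^ 'd \<Rightarrow> real) \<Rightarrow> real ^ 'd \<Rightarrow> real" where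
  "l1_integral \<gamma> \<alpha> M f =
     (if \<exists>I. has_l1_integral \<gamma> \<alpha> M f I then THE I. has_l1_integral \<gamma> \<alpha> M f I else (\<lambda>_. 0))"

definition l1_union :: "(real ^ 'd) set \<Rightarrow> real \<Rightarrow> real \<Rightarrow> (real ^ 'd \<Rightarrow> real) set" where
  "l1_union \<gamma> a b = (\<Union>\<alpha>\<in>{a..<b}. l1 \<gamma> \<alpha>)"

definition linear_on_union ::
  "(real ^ 'd) set \<Rightarrow> real \<Rightarrow> real \<Rightarrow> ((real ^ 'd \<Rightarrow> real) \<Rightarrow> real ^ 'd \<Rightarrow> real) \<Rightarrow> bool" where
  "linear_on_union \<gamma> a b Q \<longleftrightarrow>
     Q ` l1_union \<gamma> a b \<subseteq> l1_union \<gamma> a b \<and>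
     (\<forall>u\<in>l1_union \<gamma> a b. \<forall>v\<in>l1_union \<gamma> a b. Q (\<lambda>x. u x + v x) = (\<lambda>x. Q u x + Q v x)) \<and>
     (\<forall>c. \<forall>u\<in>l1_union \<gamma> a b. Q (\<lambda>x. c * u x) = (\<lambda>x. c * Q u x))"

definition ovsjannikov ::
  "(real ^ 'd) set \<Rightarrow> real \<Rightarrow> real \<Rightarrow> real \<Rightarrow> real \<Rightarrow> ((real ^ 'd \<Rightarrow> real) \<Rightarrow> real ^ 'd \<Rightarrow> real) \<Rightarrow> bool" where
  "ovsjannikov \<gamma> a b q L Q \<longleftrightarrow>
     q > 0 \<and> L > 0 \<and> linear_on_union \<gamma> a b Q \<and>
     (\<forall>\<alpha>\<in>{a..<b}. \<forall>\<beta>\<in>{a..<b}. \<alpha> < \<beta> \<longrightarrow>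
        (\<forall>u\<in>l1 \<gamma> \<alpha>. Q u \<in> l1 \<gamma> \<beta> \<and>
           l1_norm \<gamma> \<beta> (Q u) \<le> L / (\<beta> - \<alpha>) powr q * l1_norm \<gamma> \<alpha> u))"

definition generated_by ::
  "(real ^ 'd) set \<Rightarrow> real \<Rightarrow> real \<Rightarrow> ((real ^ 'd \<Rightarrow> real) \<Rightarrow> real ^ 'd \<Rightarrow> real)
     \<Rightarrow> (real ^ 'd \<Rightarrow> real ^ 'd \<Rightarrow> real) \<Rightarrow> bool" where
  "generated_by \<gamma> a b Q A \<longleftrightarrow>
     (\<forall>u\<in>l1_union \<gamma> a b. \<forall>x\<in>\<gamma>. ((\<lambda>y. A x y * u y) has_sum Q u x) \<gamma>)"

text \<open>
  The case distinction implements the convention \<open>0\<^sup>0 = 1\<close>; in the library \<open>0 powr 0 = 0\<close>.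
\<close>

definition K_term :: "real \<Rightarrow> real \<Rightarrow> real \<Rightarrow> real \<Rightarrow> real \<Rightarrow> nat \<Rightarrow> real" where
  "K_term q L T \<alpha> \<beta> n =
     L ^ n * T ^ n / (\<beta> - \<alpha>) powr (q * real n)
       * ((if n = 0 then 1 else real n powr (q * real n)) / fact n)"

definition K_const :: "real \<Rightarrow> real \<Rightarrow> real \<Rightarrow> real \<Rightarrow> real \<Rightarrow> real" where
  "K_const q L T \<alpha> \<beta> = (\<Sum>n. K_term q L T \<alpha> \<beta> n)"

end

theory Submission
  imports Defs
begin

text \<open>
  Let \<open>V\<close> be the Volterra operator \<open>(V u)(t) = \<integral>\<^sub>0\<^sup>t Q u(s) ds\<close>. By positivity of \<open>Q\<close>, iterating
  \<open>g \<le> z + V g\<close> gives \<open>g \<le> (\<Sum>n<N. V\<^sup>n z) + V\<^sup>N g\<close>. Applying the Ovsjannikov bound along \<open>n\<close> equal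
  steps from \<open>\<alpha>\<close> to \<open>\<beta>\<close> shows that \<open>V\<^sup>n\<close> maps functions bounded by \<open>B\<close> in \<open>l1 \<gamma> \<alpha>\<close> to functions
  bounded by \<open>B\<close> times the \<open>n\<close>-th term of the series for \<open>K\<^sub>T(\<alpha>, \<beta>)\<close>. That series converges, so the
  remainder \<open>V\<^sup>N g\<close> vanishes componentwise. Since \<open>V\<^sup>n z\<close> is nondecreasing in time, its value at \<open>T\<close>
  bounds the supremum over \<open>t\<close>. Working with nonnegative extended reals, only the inequality
  between components of the Bochner integral and Lebesgue integrals of the components is needed,
  and Tonelli replaces vector-valued integration.
\<close>

subsection \<open>Components of the Bochner integral\<close>

lemma l1_summable: "u \<in> l1 \<gamma> \<alpha> \<Longrightarrow> (\<lambda>x. exp (- \<alpha> * norm x) * \<bar>u x\<bar>) summable_on \<gamma>"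
  by (simp add: l1_def)

lemma l1_zero: "(\<lambda>_. 0) \<in> l1 \<gamma> \<alpha>"
  by (simp add: l1_def)

lemma l1_add:
  assumes "u \<in> l1 \<gamma> \<alpha>" "v \<in> l1 \<gamma> \<alpha>"
  shows "(\<lambda>x. u x + v x) \<in> l1 \<gamma> \<alpha>"
proof -
  have "(\<lambda>x. exp (- \<alpha> * norm x) * \<bar>u x + v x\<bar>) summable_on \<gamma>"
  proof (rule summable_on_comparison_test)
    show "(\<lambda>x. exp (- \<alpha> * norm x) * \<bar>u x\<bar> + exp (- \<alpha> * norm x) * \<bar>v x\<bar>) summable_on \<gamma>"
      using assms by (intro summable_on_add l1_summable)
    show "exp (- \<alpha> * norm x) * \<bar>u x + v x\<bar>
        \<le> exp (- \<alpha> * norm x) * \<bar>u x\<bar> + exp (- \<alpha> * norm x) * \<bar>v x\<bar>" for x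
      unfolding distrib_left[symmetric] by (intro mult_left_mono abs_triangle_ineq) auto
  qed auto
  then show ?thesis
    using assms by (simp add: l1_def)
qed

lemma l1_cmult:
  assumes "u \<in> l1 \<gamma> \<alpha>"
  shows "(\<lambda>x. c * u x) \<in> l1 \<gamma> \<alpha>"
  using assms summable_on_cmult_right[OF l1_summable[OF assms], of "\<bar>c\<bar>"]
  by (simp add: l1_def abs_mult mult_ac)

lemma l1_diff:
  assumes "u \<in> l1 \<gamma> \<alpha>" "v \<in> l1 \<gamma> \<alpha>"
  shows "(\<lambda>x. u x - v x) \<in> l1 \<gamma> \<alpha>"
  using l1_add[OF assms(1) l1_cmult[OF assms(2), of "-1"]] by simp

lemma l1_sum:
  assumes "\<And>i. i \<in> I \<Longrightarrow> f i \<in> l1 \<gamma> \<alpha>"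
  shows "(\<lambda>x. \<Sum>i\<in>I. f i x) \<in> l1 \<gamma> \<alpha>"
  using assms by (induction I rule: infinite_finite_induct) (auto intro: l1_zero l1_add)

text \<open>One term of a nonnegative series is at most its sum. Coordinate evaluation is thus
  Lipschitz on \<open>l1 \<gamma> \<alpha>\<close>, which carries measurability and limits of
  integrals over to components.\<close>

lemma abs_component_diff_le_l1_dist:
  assumes "u \<in> l1 \<gamma> \<alpha>" "v \<in> l1 \<gamma> \<alpha>" "x \<in> \<gamma>"
  shows "\<bar>u x - v x\<bar> \<le> exp (\<alpha> * norm x) * l1_dist \<gamma> \<alpha> u v"
proof -
  have "(\<Sum>\<^sub>\<infinity>y\<in>{x}. exp (- \<alpha> * norm y) * \<bar>u y - v y\<bar>) \<le> l1_dist \<gamma> \<alpha> u v"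
    unfolding l1_dist_def l1_norm_def using l1_summable[OF l1_diff[OF assms(1,2)]] assms(3)
    by (intro infsum_mono_neutral) auto
  then have "exp (\<alpha> * norm x) * (exp (- \<alpha> * norm x) * \<bar>u x - v x\<bar>)
      \<le> exp (\<alpha> * norm x) * l1_dist \<gamma> \<alpha> u v"
    by (intro mult_left_mono) auto
  then show ?thesis
    by (simp add: mult.assoc[symmetric] exp_add[symmetric])
qed

section \<open>Measurability of coordinate evaluations\<close>

lemma openin_l1_subset:
  assumes "openin (Metric_space.mtopology (l1 \<gamma> \<alpha>) (l1_dist \<gamma> \<alpha>)) U"
  shows "U \<subseteq> l1 \<gamma> \<alpha>"
  using openin_subset[OF assms] by (simp add: Metric_space.topspace_mtopology[OF Metric_space_l1])

lemma space_l1_borel: "space (l1_borel \<gamma> \<alpha>) = l1 \<gamma> \<alpha>"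
  unfolding l1_borel_def using openin_l1_subset by (intro space_measure_of) blast

lemma openin_in_sets_l1_borel:
  assumes "openin (Metric_space.mtopology (l1 \<gamma> \<alpha>) (l1_dist \<gamma> \<alpha>)) U"
  shows "U \<in> sets (l1_borel \<gamma> \<alpha>)"
proof -
  have "{U. openin (Metric_space.mtopology (l1 \<gamma> \<alpha>) (l1_dist \<gamma> \<alpha>)) U} \<subseteq> Pow (l1 \<gamma> \<alpha>)"
    using openin_l1_subset by blast
  then show ?thesis
    unfolding l1_borel_def using assms by (simp add: sets_measure_of sigma_sets.Basic)
qed

lemma borel_measurable_l1_component:
  assumes "x \<in> \<gamma>"
  shows "(\<lambda>u. u x) \<in> borel_measurable (l1_borel \<gamma> \<alpha>)"
proof (rule borel_measurableI)
  interpret Metric_space "l1 \<gamma> \<alpha>" "l1_dist \<gamma> \<alpha>" by (rule Metric_space_l1)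
  fix V :: "real set" assume "open V"
  have "openin mtopology ((\<lambda>u. u x) -` V \<inter> l1 \<gamma> \<alpha>)"
    unfolding openin_mtopology
  proof (intro conjI allI impI)
    fix u assume u: "u \<in> (\<lambda>u. u x) -` V \<inter> l1 \<gamma> \<alpha>"
    with \<open>open V\<close> obtain e where e: "e > 0" "\<And>y. dist y (u x) < e \<Longrightarrow> y \<in> V"
      by (auto simp: open_dist)
    show "\<exists>r>0. mball u r \<subseteq> (\<lambda>u. u x) -` V \<inter> l1 \<gamma> \<alpha>"
    proof (intro exI conjI subsetI)
      \<comment> \<open>The tolerance \<open>e\<close> is divided by the Lipschitz constant of
        evaluation at \<open>x\<close>.\<close>
      show "0 < e / exp (\<alpha> * norm x)" using e by simp
      fix v assume v: "v \<in> mball u (e / exp (\<alpha> * norm x))"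
      then have "\<bar>u x - v x\<bar> < e"
        using abs_component_diff_le_l1_dist[of u \<gamma> \<alpha> v x] assms
        by (auto simp: field_simps)
      then show "v \<in> (\<lambda>u. u x) -` V \<inter> l1 \<gamma> \<alpha>"
        using v e(2)[of "v x"] by (auto simp: dist_real_def abs_minus_commute)
    qed
  qed auto
  then show "(\<lambda>u. u x) -` V \<inter> space (l1_borel \<gamma> \<alpha>) \<in> sets (l1_borel \<gamma> \<alpha>)"
    unfolding space_l1_borel by (rule openin_in_sets_l1_borel)
qed

text \<open>Stated for arbitrary \<open>f\<close>, because it is applied to the distance between a
  function and its simple approximation, whose measurability in \<open>t\<close> is not established.
  Dividing a simple function below \<open>c * f\<close> by \<open>c\<close> gives a simple function
  below \<open>f\<close>.\<close>

lemma nn_integral_cmult_le: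
  fixes c :: ennreal
  assumes "c \<noteq> 0" "c < top"
  shows "(\<integral>\<^sup>+t. c * f t \<partial>M) \<le> c * (\<integral>\<^sup>+t. f t \<partial>M)"
  unfolding nn_integral_def[of M "\<lambda>t. c * f t"]
proof (rule SUP_least)
  fix h assume "h \<in> {h. simple_function M h \<and> h \<le> (\<lambda>t. c * f t)}"
  then have h: "simple_function M h" "\<And>t. h t \<le> c * f t"
    by (auto simp: le_fun_def)
  have *: "c * (h t / c) = h t" for t
    using assms unfolding ennreal_times_divide mult.commute[of c]
    by (intro ennreal_mult_divide_eq) auto
  have "integral\<^sup>S M h = (\<integral>\<^sup>+t. c * (h t / c) \<partial>M)"
    using h by (simp add: * nn_integral_eq_simple_integral)
  also have "\<dots> = c * (\<integral>\<^sup>+t. h t / c \<partial>M)"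
    using h(1) by (intro nn_integral_cmult) (auto intro: borel_measurable_simple_function)
  also have "\<dots> \<le> c * (\<integral>\<^sup>+t. f t \<partial>M)"
  proof (intro mult_left_mono nn_integral_mono)
    show "h t / c \<le> f t" for t
      using h(2)[of t] assms divide_right_mono_ennreal[of "h t" "c * f t" c]
      unfolding mult.commute[of c] by (subst (asm) ennreal_mult_divide_eq) auto
  qed auto
  finally show "integral\<^sup>S M h \<le> c * (\<integral>\<^sup>+t. f t \<partial>M)" .
qed

text \<open>Distinct values of \<open>s\<close> may share the same \<open>x\<close>-component, so
  the scalar integral is computed over the finer partition given by the values of \<open>s\<close>
  itself.\<close>

lemma l1_simple_integral_component:
  assumes "l1_simple \<gamma> \<alpha> M s"
  shows "Bochner_Integration.simple_bochner_integrable M (\<lambda>t. s t x)"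
    and "Bochner_Integration.simple_bochner_integral M (\<lambda>t. s t x) = l1_simple_integral M s x"
proof -
  have s: "simple_function M s" "emeasure M {t \<in> space M. s t \<noteq> (\<lambda>_. 0)} \<noteq> \<infinity>"
    using assms by (auto simp: l1_simple_def)
  show sb: "Bochner_Integration.simple_bochner_integrable M (\<lambda>t. s t x)"
  proof (rule simple_bochner_integrable.intros)
    show "simple_function M (\<lambda>t. s t x)"
      using simple_function_compose[OF s(1), of "\<lambda>u. u x"] by (simp add: comp_def)
    have "emeasure M {t \<in> space M. s t x \<noteq> 0} \<le> emeasure M {t \<in> space M. s t \<noteq> (\<lambda>_. 0)}"
    proof (rule emeasure_mono)
      have "(\<lambda>t. s t) -` (- {\<lambda>_. 0}) \<inter> space M \<in> sets M"
        by (rule simple_functionD(2)[OF s(1)])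
      then show "{t \<in> space M. s t \<noteq> (\<lambda>_. 0)} \<in> sets M"
        by (simp add: vimage_def Int_def conj_commute)
    qed auto
    then show "emeasure M {t \<in> space M. s t x \<noteq> 0} \<noteq> \<infinity>"
      using s(2) by (auto simp: top_unique)
  qed
  show "Bochner_Integration.simple_bochner_integral M (\<lambda>t. s t x) = l1_simple_integral M s x"
    unfolding l1_simple_integral_def
    using simple_bochner_integral_partition[OF sb s(1), of "\<lambda>u. u x"] by simp
qed

text \<open>The components of the approximating simple functions approximate the component of
  \<open>f\<close>: by the Lipschitz bound, both convergences in the definition pass to the scalar
  case at the cost of the constant \<open>exp (\<alpha> * norm x)\<close>.\<close>

lemma has_l1_integral_component:
  assumes I: "has_l1_integral \<gamma> \<alpha> M f I" and x: "x \<in> \<gamma>"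
  shows "has_bochner_integral M (\<lambda>t. f t x) (I x)"
proof -
  interpret Metric_space "l1 \<gamma> \<alpha>" "l1_dist \<gamma> \<alpha>" by (rule Metric_space_l1)
  from I obtain s where f: "f \<in> measurable M (l1_borel \<gamma> \<alpha>)" and Il: "I \<in> l1 \<gamma> \<alpha>"
    and s: "\<And>i. l1_simple \<gamma> \<alpha> M (s i)"
    and lim: "(\<lambda>i::nat. \<integral>\<^sup>+t. ennreal (l1_dist \<gamma> \<alpha> (f t) (s i t)) \<partial>M) \<longlonglongrightarrow> 0"
    and limI: "(\<lambda>i. l1_dist \<gamma> \<alpha> (l1_simple_integral M (s i)) I) \<longlonglongrightarrow> 0"
    by (auto simp: has_l1_integral_def)
  define c where "c = exp (\<alpha> * norm x)"
  have s_in: "s i t \<in> l1 \<gamma> \<alpha>" if "t \<in> space M" for i t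
    using s[of i] that by (auto simp: l1_simple_def)
  have f_in: "f t \<in> l1 \<gamma> \<alpha>" if "t \<in> space M" for t
    using measurable_space[OF f that] by (simp add: space_l1_borel)
  have int_in: "l1_simple_integral M (s i) \<in> l1 \<gamma> \<alpha>" for i
    unfolding l1_simple_integral_def using s_in by (intro l1_sum l1_cmult) auto
  show ?thesis
  proof (rule has_bochner_integral.intros)
    show "(\<lambda>t. f t x) \<in> borel_measurable M"
      using measurable_compose[OF f borel_measurable_l1_component[OF x]] .
    show "Bochner_Integration.simple_bochner_integrable M (\<lambda>t. s i t x)" for i
      by (rule l1_simple_integral_component(1)[OF s])
    have bd: "(\<integral>\<^sup>+t. norm (f t x - s i t x) \<partial>M)
        \<le> ennreal c * (\<integral>\<^sup>+t. ennreal (l1_dist \<gamma> \<alpha> (f t) (s i t)) \<partial>M)" for i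
    proof -
      have "(\<integral>\<^sup>+t. norm (f t x - s i t x) \<partial>M)
          \<le> (\<integral>\<^sup>+t. ennreal c * ennreal (l1_dist \<gamma> \<alpha> (f t) (s i t)) \<partial>M)"
        using abs_component_diff_le_l1_dist[OF f_in s_in x]
        by (intro nn_integral_mono) (auto simp: c_def ennreal_mult[symmetric] intro!: ennreal_leI)
      also have "\<dots> \<le> ennreal c * (\<integral>\<^sup>+t. ennreal (l1_dist \<gamma> \<alpha> (f t) (s i t)) \<partial>M)"
        by (intro nn_integral_cmult_le) (auto simp: c_def)
      finally show ?thesis .
    qed
    have "(\<lambda>i. ennreal c * (\<integral>\<^sup>+t. ennreal (l1_dist \<gamma> \<alpha> (f t) (s i t)) \<partial>M)) \<longlonglongrightarrow> ennreal c * 0"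
      by (intro ennreal_tendsto_cmult lim) simp
    then have bd0: "(\<lambda>i. ennreal c * (\<integral>\<^sup>+t. ennreal (l1_dist \<gamma> \<alpha> (f t) (s i t)) \<partial>M)) \<longlonglongrightarrow> 0"
      by simp
    show "(\<lambda>i. \<integral>\<^sup>+t. norm (f t x - s i t x) \<partial>M) \<longlonglongrightarrow> 0"
      by (rule tendsto_sandwich[OF _ _ tendsto_const bd0]) (simp_all only: bd zero_le eventually_True)
    have "(\<lambda>i. l1_simple_integral M (s i) x - I x) \<longlonglongrightarrow> 0"
    proof (rule Lim_null_comparison)
      show "\<forall>\<^sub>F i in sequentially. norm (l1_simple_integral M (s i) x - I x)
          \<le> c * l1_dist \<gamma> \<alpha> (l1_simple_integral M (s i)) I"
        using abs_component_diff_le_l1_dist[OF int_in Il x] by (simp add: c_def)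
      show "(\<lambda>i. c * l1_dist \<gamma> \<alpha> (l1_simple_integral M (s i)) I) \<longlonglongrightarrow> 0"
        using tendsto_mult_right_zero[OF limI] .
    qed
    then show "(\<lambda>i. Bochner_Integration.simple_bochner_integral M (\<lambda>t. s i t x)) \<longlonglongrightarrow> I x"
      unfolding l1_simple_integral_component(2)[OF s] by (simp add: LIM_zero_iff)
  qed
qed

text \<open>Uniqueness of the integral: on \<gamma> each component is a scalar Bochner integral, and
  off \<gamma> every member of \<open>l1 \<gamma> \<alpha>\<close> vanishes.\<close>

lemma l1_integral_eq:
  assumes I: "has_l1_integral \<gamma> \<alpha> M f I"
  shows "l1_integral \<gamma> \<alpha> M f = I"
proof -
  have "J = I" if J: "has_l1_integral \<gamma> \<alpha> M f J" for J
  proof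
    fix x
    show "J x = I x"
    proof (cases "x \<in> \<gamma>")
      case True
      then show ?thesis
        using has_bochner_integral_eq[OF has_l1_integral_component[OF J] has_l1_integral_component[OF I]]
        by simp
    next
      case False
      then show ?thesis using I J by (simp add: has_l1_integral_def l1_def)
    qed
  qed
  then have "(THE I. has_l1_integral \<gamma> \<alpha> M f I) = I"
    using I by (intro the_equality)
  moreover have "\<exists>I. has_l1_integral \<gamma> \<alpha> M f I"
    using I by blast
  ultimately show ?thesis
    by (simp only: l1_integral_def if_True)
qed

text \<open>If \<open>f\<close> has no integral, the bound holds because \<open>l1_integral\<close> is then \<open>0\<close>.\<close>

lemma l1_integral_le_nn_integral:
  assumes "x \<in> \<gamma>" and nonneg: "\<And>t. t \<in> space M \<Longrightarrow> 0 \<le> f t x"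
  shows "ennreal (l1_integral \<gamma> \<alpha> M f x) \<le> (\<integral>\<^sup>+t. ennreal (f t x) \<partial>M)"
proof (cases "\<exists>I. has_l1_integral \<gamma> \<alpha> M f I")
  case True
  then obtain I where I: "has_l1_integral \<gamma> \<alpha> M f I" by blast
  have "has_bochner_integral M (\<lambda>t. f t x) (I x)"
    by (rule has_l1_integral_component[OF I assms(1)])
  then have "(\<integral>\<^sup>+t. ennreal (f t x) \<partial>M) = ennreal (I x)"
    using nn_integral_eq_integral[of M "\<lambda>t. f t x"] nonneg by (auto simp: has_bochner_integral_iff)
  then show ?thesis
    by (simp add: l1_integral_eq[OF I])
qed (simp add: l1_integral_def)

subsection \<open>Weighted norms and the Volterra operator\<close>

text \<open>Extends \<open>l1_norm\<close> to all functions with values in [0, \<infinity>].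
  Membership in the weighted space becomes finiteness, so norms can be estimated before summability
  is known.\<close>

definition wnorm :: "(real ^ 'd) set \<Rightarrow> real \<Rightarrow> (real ^ 'd \<Rightarrow> ennreal) \<Rightarrow> ennreal" where
  "wnorm \<gamma> \<beta> u = (\<integral>\<^sup>+x. ennreal (exp (- \<beta> * norm x)) * u x \<partial>count_space \<gamma>)"

definition mat_op :: "(real ^ 'd) set \<Rightarrow> (real ^ 'd \<Rightarrow> real ^ 'd \<Rightarrow> real)
    \<Rightarrow> (real ^ 'd \<Rightarrow> ennreal) \<Rightarrow> real ^ 'd \<Rightarrow> ennreal" where
  "mat_op \<gamma> A u x = (\<integral>\<^sup>+y. ennreal (A x y) * u y \<partial>count_space \<gamma>)"

text \<open>The upper limit \<open>t\<close> is encoded by an indicator, so that all times share one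
  measure on [0, T]; measurability in \<open>t\<close> and monotonicity in \<open>t\<close> are then
  read off the integrand.\<close>

definition volterra :: "(real ^ 'd) set \<Rightarrow> (real ^ 'd \<Rightarrow> real ^ 'd \<Rightarrow> real) \<Rightarrow> real
    \<Rightarrow> (real \<Rightarrow> real ^ 'd \<Rightarrow> ennreal) \<Rightarrow> real \<Rightarrow> real ^ 'd \<Rightarrow> ennreal" where
  "volterra \<gamma> A T u t x =
     (\<integral>\<^sup>+s. indicator {..t} s * mat_op \<gamma> A (u s) x \<partial>lebesgue_on {0..T})"

section \<open>Sums over \<gamma> as integrals against counting measure\<close>

lemma locally_finite_set_countable:
  fixes \<gamma> :: "(real ^ 'd) set"
  assumes "locally_finite_set \<gamma>"
  shows "countable \<gamma>"
proof -
  have "\<exists>n::nat. x \<in> cball 0 (real n)" for x :: "real ^ 'd"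
    using real_arch_simple[of "norm x"] by simp
  then have "\<gamma> = (\<Union>n::nat. \<gamma> \<inter> cball 0 (real n))"
    by blast
  also have "countable \<dots>"
    using assms by (intro countable_UN) (auto simp: locally_finite_set_def intro: countable_finite)
  finally show ?thesis .
qed

lemma nn_integral_count_space_eq_infsum:
  fixes f :: "'a \<Rightarrow> real"
  assumes "\<And>x. x \<in> S \<Longrightarrow> 0 \<le> f x" "f summable_on S"
  shows "(\<integral>\<^sup>+x. ennreal (f x) \<partial>count_space S) = ennreal (infsum f S)"
proof -
  have "Infinite_Sum.abs_summable_on f S"
    using assms(2) by (rule summable_on_iff_abs_summable_on_real[THEN iffD1])
  then have *: "Infinite_Set_Sum.abs_summable_on f S"
    by (rule abs_summable_equivalent[THEN iffD1])
  show ?thesis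
    using nn_integral_conv_infsetsum[OF * assms(1)] infsetsum_infsum[OF *] by simp
qed

lemma summable_on_of_nn_integral_count_space:
  fixes f :: "'a \<Rightarrow> real"
  assumes "\<And>x. x \<in> S \<Longrightarrow> 0 \<le> f x" "(\<integral>\<^sup>+x. ennreal (f x) \<partial>count_space S) < \<infinity>"
  shows "f summable_on S"
proof -
  have "integrable (count_space S) f"
    using assms by (intro integrableI_nonneg) (simp_all add: AE_count_space)
  then have "Infinite_Set_Sum.abs_summable_on f S"
    by (simp add: Infinite_Set_Sum.abs_summable_on_def)
  then show ?thesis
    by (rule abs_summable_summable[OF abs_summable_equivalent[THEN iffD2]])
qed

text \<open>On a countable index set, measurability for each fixed index already gives joint
  measurability, and counting measure is sigma-finite, so parametrised integrals are
  measurable.\<close>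

lemma borel_measurable_nn_integral_count_space:
  assumes "countable S" "\<And>y. y \<in> S \<Longrightarrow> (\<lambda>t. f t y) \<in> borel_measurable M"
  shows "(\<lambda>t. \<integral>\<^sup>+y. f t y \<partial>count_space S) \<in> borel_measurable M"
proof -
  interpret sigma_finite_measure "count_space S"
    using assms(1) by (rule sigma_finite_measure_count_space_countable)
  have "(\<lambda>p. f (snd p) (fst p)) \<in> borel_measurable (count_space S \<Otimes>\<^sub>M M)"
    using assms by (intro measurable_pair_measure_countable1) auto
  then have "(\<lambda>(t, y). f t y) \<in> borel_measurable (M \<Otimes>\<^sub>M count_space S)"
    by (subst measurable_pair_swap_iff) (simp add: case_prod_beta)
  then show ?thesis
    by (rule borel_measurable_nn_integral)
qed

section \<open>The matrix operator and weighted norms in extended reals\<close>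

lemma mat_op_mono: "(\<And>y. y \<in> \<gamma> \<Longrightarrow> u y \<le> v y) \<Longrightarrow> mat_op \<gamma> A u x \<le> mat_op \<gamma> A v x"
  unfolding mat_op_def by (intro nn_integral_mono mult_left_mono) auto

lemma mat_op_add: "mat_op \<gamma> A (\<lambda>y. u y + v y) x = mat_op \<gamma> A u x + mat_op \<gamma> A v x"
  unfolding mat_op_def by (simp add: distrib_left nn_integral_add)

lemma borel_measurable_mat_op:
  assumes "countable \<gamma>" "\<And>y. y \<in> \<gamma> \<Longrightarrow> (\<lambda>t. u t y) \<in> borel_measurable M"
  shows "(\<lambda>t. mat_op \<gamma> A (u t) x) \<in> borel_measurable M"
  unfolding mat_op_def using assms
  by (intro borel_measurable_nn_integral_count_space borel_measurable_times) auto

lemma wnorm_antimono_exponent: "\<beta> \<le> \<beta>' \<Longrightarrow> wnorm \<gamma> \<beta>' u \<le> wnorm \<gamma> \<beta> u"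
  unfolding wnorm_def
  by (intro nn_integral_mono mult_right_mono ennreal_leI) (auto intro: mult_right_mono)

lemma wnorm_suminf: "wnorm \<gamma> \<beta> (\<lambda>x. \<Sum>n. u n x) = (\<Sum>n. wnorm \<gamma> \<beta> (u n))"
  unfolding wnorm_def by (simp add: nn_integral_suminf flip: ennreal_suminf_cmult)

lemma component_le_wnorm:
  assumes "x \<in> \<gamma>"
  shows "u x \<le> ennreal (exp (\<beta> * norm x)) * wnorm \<gamma> \<beta> u"
proof -
  have "ennreal (exp (- \<beta> * norm x)) * u x \<le> wnorm \<gamma> \<beta> u"
    unfolding wnorm_def by (rule nn_integral_ge_point[OF assms])
  then have "ennreal (exp (\<beta> * norm x)) * (ennreal (exp (- \<beta> * norm x)) * u x)
      \<le> ennreal (exp (\<beta> * norm x)) * wnorm \<gamma> \<beta> u"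
    by (rule mult_left_mono) simp
  then show ?thesis
    by (simp add: mult.assoc[symmetric] ennreal_mult[symmetric] exp_add[symmetric])
qed

lemma wnorm_real:
  assumes "u \<in> l1 \<gamma> \<alpha>" "\<And>x. x \<in> \<gamma> \<Longrightarrow> 0 \<le> u x"
  shows "wnorm \<gamma> \<alpha> (\<lambda>x. ennreal (u x)) = ennreal (l1_norm \<gamma> \<alpha> u)"
proof -
  have "wnorm \<gamma> \<alpha> (\<lambda>x. ennreal (u x))
      = (\<integral>\<^sup>+x. ennreal (exp (- \<alpha> * norm x) * \<bar>u x\<bar>) \<partial>count_space \<gamma>)"
    unfolding wnorm_def using assms(2) by (intro nn_integral_cong) (simp add: ennreal_mult)
  also have "\<dots> = ennreal (l1_norm \<gamma> \<alpha> u)"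
    unfolding l1_norm_def using assms(1)
    by (intro nn_integral_count_space_eq_infsum) (auto simp: l1_def)
  finally show ?thesis .
qed

text \<open>With nonnegative entries and nonnegative \<open>u\<close>, the convergent sum defining
  \<open>Q u x\<close> is also an integral against counting measure, so \<open>mat_op\<close>
  extends the action of \<open>Q\<close>.\<close>

lemma mat_op_real:
  assumes gen: "generated_by \<gamma> a b Q A" and pos: "\<forall>x\<in>\<gamma>. \<forall>y\<in>\<gamma>. A x y \<ge> 0"
    and u: "u \<in> l1 \<gamma> \<alpha>" "\<alpha> \<in> {a..<b}" "\<And>x. x \<in> \<gamma> \<Longrightarrow> 0 \<le> u x" and x: "x \<in> \<gamma>"
  shows "mat_op \<gamma> A (\<lambda>y. ennreal (u y)) x = ennreal (Q u x)" "0 \<le> Q u x"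
proof -
  have sum: "((\<lambda>y. A x y * u y) has_sum Q u x) \<gamma>"
    using gen u x by (auto simp: generated_by_def l1_union_def)
  then show "0 \<le> Q u x"
    by (rule has_sum_nonneg) (use pos x u in auto)
  have "mat_op \<gamma> A (\<lambda>y. ennreal (u y)) x = (\<integral>\<^sup>+y. ennreal (A x y * u y) \<partial>count_space \<gamma>)"
    unfolding mat_op_def using u pos x by (intro nn_integral_cong) (simp add: ennreal_mult)
  also have "\<dots> = ennreal (infsum (\<lambda>y. A x y * u y) \<gamma>)"
    using sum pos x u by (intro nn_integral_count_space_eq_infsum) (auto simp: summable_on_def)
  also have "\<dots> = ennreal (Q u x)"
    using infsumI[OF sum] by simp
  finally show "mat_op \<gamma> A (\<lambda>y. ennreal (u y)) x = ennreal (Q u x)" .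
qed

text \<open>Transfers the Ovsjannikov bound to extended reals. If the norm of \<open>u\<close> is
  infinite, so is the right-hand side because L > 0; otherwise \<open>u\<close> is finite on
  \<gamma> and comes from a member of \<open>l1 \<gamma> \<alpha>\<close>.\<close>

lemma wnorm_mat_op_le:
  assumes ovs: "ovsjannikov \<gamma> a b q L Q" and gen: "generated_by \<gamma> a b Q A"
    and pos: "\<forall>x\<in>\<gamma>. \<forall>y\<in>\<gamma>. A x y \<ge> 0"
    and \<alpha>: "a \<le> \<alpha>" "\<alpha> < \<beta>" "\<beta> < b"
  shows "wnorm \<gamma> \<beta> (mat_op \<gamma> A u) \<le> ennreal (L / (\<beta> - \<alpha>) powr q) * wnorm \<gamma> \<alpha> u"
proof (cases "wnorm \<gamma> \<alpha> u = top")
  case True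
  then show ?thesis
    using ovs \<alpha> by (simp add: ovsjannikov_def ennreal_mult_top)
next
  case False
  have fin: "u x < top" if "x \<in> \<gamma>" for x
  proof -
    have "u x \<le> ennreal (exp (\<alpha> * norm x)) * wnorm \<gamma> \<alpha> u"
      by (rule component_le_wnorm[OF that])
    also have "\<dots> < top"
      using False by (simp add: ennreal_mult_less_top less_top)
    finally show ?thesis .
  qed
  \<comment> \<open>Extension by 0 is required for membership in
    \<open>l1 \<gamma> \<alpha>\<close>; neither \<open>wnorm\<close> nor \<open>mat_op\<close> sees
    values of \<open>u\<close> off \<gamma>.\<close>
  define v where "v x = (if x \<in> \<gamma> then enn2real (u x) else 0)" for x
  have uv: "u x = ennreal (v x)" if "x \<in> \<gamma>" for x
    using fin[OF that] that by (simp add: v_def)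
  have v0: "0 \<le> v x" for x by (simp add: v_def)
  have wuv: "wnorm \<gamma> \<alpha> u = wnorm \<gamma> \<alpha> (\<lambda>x. ennreal (v x))"
    unfolding wnorm_def by (intro nn_integral_cong) (simp add: uv)
  have "(\<lambda>x. exp (- \<alpha> * norm x) * \<bar>v x\<bar>) summable_on \<gamma>"
  proof (rule summable_on_of_nn_integral_count_space)
    have "(\<integral>\<^sup>+x. ennreal (exp (- \<alpha> * norm x) * \<bar>v x\<bar>) \<partial>count_space \<gamma>) = wnorm \<gamma> \<alpha> u"
      unfolding wuv unfolding wnorm_def using v0 by (intro nn_integral_cong) (simp add: ennreal_mult)
    then show "(\<integral>\<^sup>+x. ennreal (exp (- \<alpha> * norm x) * \<bar>v x\<bar>) \<partial>count_space \<gamma>) < \<infinity>"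
      using False by (simp add: less_top)
  qed auto
  then have v: "v \<in> l1 \<gamma> \<alpha>"
    by (simp add: l1_def v_def)
  have \<alpha>b: "\<alpha> \<in> {a..<b}" using \<alpha> by simp
  have Qv: "Q v \<in> l1 \<gamma> \<beta>" "l1_norm \<gamma> \<beta> (Q v) \<le> L / (\<beta> - \<alpha>) powr q * l1_norm \<gamma> \<alpha> v"
    using ovs \<alpha> \<alpha>b v unfolding ovsjannikov_def by (meson atLeastLessThan_iff less_imp_le order_trans)+
  have "mat_op \<gamma> A u x = ennreal (Q v x)" if "x \<in> \<gamma>" for x
  proof -
    have "mat_op \<gamma> A u x = mat_op \<gamma> A (\<lambda>y. ennreal (v y)) x"
      unfolding mat_op_def by (intro nn_integral_cong) (simp add: uv)
    then show ?thesis
      using mat_op_real(1)[OF gen pos v \<alpha>b v0 that] by simp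
  qed
  then have "wnorm \<gamma> \<beta> (mat_op \<gamma> A u) = wnorm \<gamma> \<beta> (\<lambda>x. ennreal (Q v x))"
    unfolding wnorm_def by (intro nn_integral_cong) simp
  also have "\<dots> = ennreal (l1_norm \<gamma> \<beta> (Q v))"
    using mat_op_real(2)[OF gen pos v \<alpha>b v0] by (intro wnorm_real Qv)
  also have "\<dots> \<le> ennreal (L / (\<beta> - \<alpha>) powr q * l1_norm \<gamma> \<alpha> v)"
    by (intro ennreal_leI Qv)
  also have "\<dots> = ennreal (L / (\<beta> - \<alpha>) powr q) * wnorm \<gamma> \<alpha> u"
    unfolding wuv wnorm_real[OF v v0] using ovs
    by (intro ennreal_mult) (auto simp: ovsjannikov_def l1_norm_def intro!: infsum_nonneg)
  finally show ?thesis .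
qed

section \<open>The Volterra operator: measurability, Tonelli, monotonicity\<close>

lemma borel_measurable_volterra:
  assumes "countable \<gamma>" "\<And>y. y \<in> \<gamma> \<Longrightarrow> (\<lambda>t. u t y) \<in> borel_measurable (lebesgue_on {0..T})"
  shows "(\<lambda>t. volterra \<gamma> A T u t x) \<in> borel_measurable (lebesgue_on {0..T})"
proof -
  let ?M = "lebesgue_on {0..T}"
  interpret finite_measure ?M
    by (intro finite_measure_lebesgue_on) auto
  have [measurable]: "(\<lambda>s. mat_op \<gamma> A (u s) x) \<in> borel_measurable ?M"
    by (rule borel_measurable_mat_op[OF assms])
  have [measurable]: "(\<lambda>s. s) \<in> borel_measurable ?M"
    by (intro measurable_restrict_space1 measurable_completion) simp
  \<comment> \<open>The triangle of pairs with s \<le> t is measurable, so the integrand is jointly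
    measurable in (t, s), and integrating out \<open>s\<close> leaves a measurable function of
    \<open>t\<close>.\<close>
  have "Measurable.pred (?M \<Otimes>\<^sub>M ?M) (\<lambda>p. snd p \<le> fst p)"
    by measurable
  then have [measurable]: "(\<lambda>p. indicator {..fst p} (snd p) :: ennreal) \<in> borel_measurable (?M \<Otimes>\<^sub>M ?M)"
    by (simp add: indicator_def)
  have "(\<lambda>(t, s). indicator {..t} s * mat_op \<gamma> A (u s) x) \<in> borel_measurable (?M \<Otimes>\<^sub>M ?M)"
    unfolding case_prod_beta by measurable
  then show ?thesis
    unfolding volterra_def by (rule borel_measurable_nn_integral)
qed

text \<open>Tonelli: the weighted sum over the countable set \<gamma> is exchanged with the time
  integral, so that a bound on \<open>mat_op\<close> at each time can be integrated.\<close>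

lemma wnorm_volterra:
  assumes \<gamma>: "countable \<gamma>"
    and u: "\<And>y. y \<in> \<gamma> \<Longrightarrow> (\<lambda>t. u t y) \<in> borel_measurable (lebesgue_on {0..T})"
  shows "wnorm \<gamma> \<beta> (volterra \<gamma> A T u t) =
    (\<integral>\<^sup>+s. indicator {..t} s * wnorm \<gamma> \<beta> (mat_op \<gamma> A (u s)) \<partial>lebesgue_on {0..T})"
proof -
  let ?M = "lebesgue_on {0..T}"
  have [measurable]: "(\<lambda>s. mat_op \<gamma> A (u s) x) \<in> borel_measurable ?M" for x
    by (rule borel_measurable_mat_op[OF assms])
  have [measurable]: "(\<lambda>s. indicator {..t} s :: ennreal) \<in> borel_measurable ?M"
    by (intro measurable_restrict_space1 measurable_completion) simp
  have "wnorm \<gamma> \<beta> (volterra \<gamma> A T u t) =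
      (\<integral>\<^sup>+x. \<integral>\<^sup>+s. ennreal (exp (- \<beta> * norm x)) * (indicator {..t} s * mat_op \<gamma> A (u s) x) \<partial>?M \<partial>count_space \<gamma>)"
    unfolding wnorm_def volterra_def by (intro nn_integral_cong nn_integral_cmult[symmetric]) measurable
  also have "\<dots> = (\<integral>\<^sup>+s. \<integral>\<^sup>+x. ennreal (exp (- \<beta> * norm x)) * (indicator {..t} s * mat_op \<gamma> A (u s) x) \<partial>count_space \<gamma> \<partial>?M)"
    by (intro nn_integral_count_space_nn_integral[symmetric] \<gamma>) measurable
  also have "\<dots> = (\<integral>\<^sup>+s. indicator {..t} s * wnorm \<gamma> \<beta> (mat_op \<gamma> A (u s)) \<partial>?M)"
    unfolding wnorm_def by (intro nn_integral_cong) (simp add: mult.left_commute nn_integral_cmult)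
  finally show ?thesis .
qed

lemma volterra_mono:
  assumes "\<And>s y. s \<in> {0..T} \<Longrightarrow> y \<in> \<gamma> \<Longrightarrow> u s y \<le> v s y"
  shows "volterra \<gamma> A T u t x \<le> volterra \<gamma> A T v t x"
  unfolding volterra_def using assms by (intro nn_integral_mono mult_left_mono mat_op_mono) auto

lemma volterra_mono_time: "t \<le> t' \<Longrightarrow> volterra \<gamma> A T u t x \<le> volterra \<gamma> A T u t' x"
  unfolding volterra_def by (intro nn_integral_mono mult_right_mono) (auto simp: indicator_def)

lemma volterra_add:
  assumes \<gamma>: "countable \<gamma>"
    and u: "\<And>y. y \<in> \<gamma> \<Longrightarrow> (\<lambda>t. u t y) \<in> borel_measurable (lebesgue_on {0..T})"
    and v: "\<And>y. y \<in> \<gamma> \<Longrightarrow> (\<lambda>t. v t y) \<in> borel_measurable (lebesgue_on {0..T})"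
  shows "volterra \<gamma> A T (\<lambda>t y. u t y + v t y) t x = volterra \<gamma> A T u t x + volterra \<gamma> A T v t x"
proof -
  have "(\<lambda>s. indicator {..t} s :: ennreal) \<in> borel_measurable (lebesgue_on {0..T})"
    by (intro measurable_restrict_space1 measurable_completion) simp
  note [measurable] = this borel_measurable_mat_op[OF \<gamma> u] borel_measurable_mat_op[OF \<gamma> v]
  show ?thesis
    unfolding volterra_def mat_op_add distrib_left
    by (rule nn_integral_add) measurable
qed

text \<open>Source of the factorial in \<open>K_term\<close>: each time integration turns t^k/k!
  into the next such monomial.\<close>

lemma nn_integral_power_lebesgue_on:
  assumes "t \<in> {0..T}"
  shows "(\<integral>\<^sup>+s. indicator {..t} s * ennreal (s ^ k / fact k) \<partial>lebesgue_on {0..T})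
    = ennreal (t ^ Suc k / fact (Suc k))"
proof -
  have "((\<lambda>s. s ^ k / fact k) has_integral (t ^ Suc k / fact (Suc k) - 0 ^ Suc k / fact (Suc k))) {0..t}"
    using assms
  proof (intro fundamental_theorem_of_calculus)
    have "real (Suc k) * s ^ k / fact (Suc k) = s ^ k / fact k" for s :: real
      by (simp only: fact_Suc of_nat_mult mult_divide_mult_cancel_left)
    moreover have "((\<lambda>s. s ^ Suc k / fact (Suc k)) has_real_derivative real (Suc k) * s ^ k / fact (Suc k)) (at s within {0..t})" for s
      using DERIV_cdivide[OF DERIV_pow[of "Suc k" s "{0..t}"], of "fact (Suc k)"] by simp
    ultimately show "((\<lambda>s. s ^ Suc k / fact (Suc k)) has_vector_derivative s ^ k / fact k) (at s within {0..t})" for s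
      by (simp only: has_real_derivative_iff_has_vector_derivative[symmetric])
  qed (use assms in auto)
  then have I: "((\<lambda>s. s ^ k / fact k) has_integral (t ^ Suc k / fact (Suc k))) {0..t}"
    by simp
  have "(\<integral>\<^sup>+s. indicator {..t} s * ennreal (s ^ k / fact k) \<partial>lebesgue_on {0..T})
      = (\<integral>\<^sup>+s. ennreal (s ^ k / fact k) * indicator {0..t} s \<partial>lebesgue)"
    using assms
    by (subst nn_integral_restrict_space) (auto intro!: nn_integral_cong simp: indicator_def)
  also have "\<dots> = (\<integral>\<^sup>+s. ennreal (s ^ k / fact k) * indicator {0..t} s \<partial>lborel)"
    by (subst nn_integral_completion) auto
  also have "\<dots> = ennreal (t ^ Suc k / fact (Suc k))"
    by (rule nn_integral_has_integral_lebesgue'[OF _ I]) auto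
  finally show ?thesis .
qed

lemma borel_measurable_volterra_power:
  assumes "countable \<gamma>" "\<And>y. y \<in> \<gamma> \<Longrightarrow> (\<lambda>t. u t y) \<in> borel_measurable (lebesgue_on {0..T})" "y \<in> \<gamma>"
  shows "(\<lambda>t. (volterra \<gamma> A T ^^ k) u t y) \<in> borel_measurable (lebesgue_on {0..T})"
  using assms(3) by (induction k arbitrary: y) (auto intro: assms(2) borel_measurable_volterra[OF assms(1)])

subsection \<open>Convergence of the series\<close>

lemma K_term_0: "\<alpha> < \<beta> \<Longrightarrow> K_term q L T \<alpha> \<beta> 0 = 1"
  by (simp add: K_term_def)

text \<open>Exhibits the n-th term as the product of n Ovsjannikov constants for steps of length
  (\<beta> - \<alpha>)/n and the factor from n time integrations.\<close>

lemma K_term_eq: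
  assumes "n > 0" "\<alpha> < \<beta>"
  shows "K_term q L T \<alpha> \<beta> n = (L / ((\<beta> - \<alpha>) / real n) powr q) ^ n * (T ^ n / fact n)"
proof -
  have "(x powr q) ^ n = x powr (q * real n)" if "x > 0" for x :: real
    using that by (simp add: powr_powr flip: powr_realpow)
  then show ?thesis
    using assms by (simp add: K_term_def powr_divide power_divide power_mult_distrib)
qed

lemma K_term_nonneg: "L \<ge> 0 \<Longrightarrow> T \<ge> 0 \<Longrightarrow> 0 \<le> K_term q L T \<alpha> \<beta> n"
  by (simp add: K_term_def)

text \<open>The single term n^n/n! of the exponential series at n is at most exp n.\<close>

lemma inverse_fact_le:
  assumes "n > 0"
  shows "1 / fact n \<le> (exp 1 / real n) ^ n"
proof -
  have "(\<Sum>k\<in>{n}. real n ^ k /\<^sub>R fact k) \<le> (\<Sum>k. real n ^ k /\<^sub>R fact k)"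
    by (intro sum_le_suminf summable_exp_generic) auto
  then have "real n ^ n / fact n \<le> exp (real n)"
    by (simp add: exp_def divide_inverse mult.commute)
  also have "exp (real n) = exp 1 ^ n"
    by (simp flip: exp_of_nat_mult)
  finally show ?thesis
    using assms by (simp add: power_divide field_simps)
qed

text \<open>Since 1/n! \<le> (e/n)^n, the n-th term is at most the n-th power of C n^(q-1). As q < 1
  this base tends to 0, and the series is eventually dominated by a geometric one.\<close>

lemma summable_K_term:
  assumes q: "q < 1" and L: "L \<ge> 0" and T: "T \<ge> 0" and "\<alpha> < \<beta>"
  shows "summable (K_term q L T \<alpha> \<beta>)"
proof -
  define C where "C = L * T / (\<beta> - \<alpha>) powr q * exp 1"
  have C: "C \<ge> 0" using L T by (simp add: C_def)
  have le: "K_term q L T \<alpha> \<beta> n \<le> (C * real n powr (q - 1)) ^ n" if n: "n > 0" for n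
  proof -
    have "K_term q L T \<alpha> \<beta> n = (L * T / (\<beta> - \<alpha>) powr q * real n powr q) ^ n * (1 / fact n)"
      using n \<open>\<alpha> < \<beta>\<close> by (simp add: K_term_eq powr_divide power_divide power_mult_distrib)
    also have "\<dots> \<le> (L * T / (\<beta> - \<alpha>) powr q * real n powr q) ^ n * (exp 1 / real n) ^ n"
      using L T by (intro mult_left_mono inverse_fact_le n) auto
    also have "\<dots> = (C * real n powr (q - 1)) ^ n"
      using n by (simp add: C_def powr_diff mult_ac flip: power_mult_distrib)
    finally show ?thesis .
  qed
  have "((\<lambda>n. C * real n powr (q - 1)) \<longlongrightarrow> C * 0) sequentially"
    using q by (intro tendsto_mult tendsto_const tendsto_neg_powr filterlim_real_sequentially) auto
  then have "\<forall>\<^sub>F n in sequentially. C * real n powr (q - 1) < 1 / 2"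
    by (rule order_tendstoD(2)) simp
  then have "\<forall>\<^sub>F n in sequentially. norm (K_term q L T \<alpha> \<beta> n) \<le> (1 / 2) ^ n"
    using eventually_gt_at_top[of 0]
  proof eventually_elim
    case (elim n)
    have "K_term q L T \<alpha> \<beta> n \<le> (C * real n powr (q - 1)) ^ n"
      using le elim by simp
    also have "\<dots> \<le> (1 / 2) ^ n"
      using C elim by (intro power_mono) auto
    finally show ?case
      using K_term_nonneg[OF L T, of q \<alpha> \<beta> n] by simp
  qed
  then show ?thesis
    by (rule summable_comparison_test_ev) (simp add: summable_geometric)
qed

subsection \<open>Iteration of the integral inequality\<close>

text \<open>Each application of \<open>volterra\<close> raises the weight exponent by h, which costs
  the factor L/h^q, while the time integrations accumulate to t^k/k!.\<close>

lemma wnorm_volterra_power_le: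
  fixes h :: real
  assumes ovs: "ovsjannikov \<gamma> a b q L Q" and gen: "generated_by \<gamma> a b Q A"
    and pos: "\<forall>x\<in>\<gamma>. \<forall>y\<in>\<gamma>. A x y \<ge> 0" and \<gamma>: "countable \<gamma>"
    and u: "\<And>y. y \<in> \<gamma> \<Longrightarrow> (\<lambda>t. u t y) \<in> borel_measurable (lebesgue_on {0..T})"
    and B: "\<And>t. t \<in> {0..T} \<Longrightarrow> wnorm \<gamma> \<alpha> (u t) \<le> B"
    and h: "h > 0" and a: "a \<le> \<alpha>"
    and "\<alpha> + real k * h < b" "t \<in> {0..T}"
  shows "wnorm \<gamma> (\<alpha> + real k * h) ((volterra \<gamma> A T ^^ k) u t)
    \<le> B * ennreal ((L / h powr q) ^ k * (t ^ k / fact k))"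
  using assms(9,10)
proof (induction k arbitrary: t)
  case 0
  then show ?case using B by simp
next
  case (Suc k)
  define c where "c = L / h powr q"
  define w where "w = (volterra \<gamma> A T ^^ k) u"
  let ?M = "lebesgue_on {0..T}"
  let ?\<beta> = "\<alpha> + real k * h" and ?\<beta>' = "\<alpha> + real (Suc k) * h"
  have c: "c \<ge> 0" using ovs by (simp add: c_def ovsjannikov_def)
  have \<beta>': "?\<beta>' - ?\<beta> = h" by (simp add: algebra_simps)
  have \<beta>: "a \<le> ?\<beta>" "?\<beta> < ?\<beta>'" "?\<beta> < b"
    using a h Suc.prems(1) by (auto simp: algebra_simps add_increasing2 intro: less_trans[rotated])
  have [measurable]: "(\<lambda>s. indicator {..t} s :: ennreal) \<in> borel_measurable ?M"
    by (intro measurable_restrict_space1 measurable_completion) simp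
  have [measurable]: "(\<lambda>s. ennreal (s ^ k / fact k)) \<in> borel_measurable ?M"
    by (intro measurable_restrict_space1 measurable_completion) simp
  have "wnorm \<gamma> ?\<beta>' ((volterra \<gamma> A T ^^ Suc k) u t)
      = (\<integral>\<^sup>+s. indicator {..t} s * wnorm \<gamma> ?\<beta>' (mat_op \<gamma> A (w s)) \<partial>?M)"
    using borel_measurable_volterra_power[OF \<gamma> u] by (simp add: w_def wnorm_volterra[OF \<gamma>])
  also have "\<dots> \<le> (\<integral>\<^sup>+s. (B * ennreal (c ^ Suc k)) * (indicator {..t} s * ennreal (s ^ k / fact k)) \<partial>?M)"
  proof (intro nn_integral_mono)
    fix s assume "s \<in> space ?M"
    then have s: "s \<in> {0..T}" by simp
    have "wnorm \<gamma> ?\<beta>' (mat_op \<gamma> A (w s)) \<le> ennreal c * wnorm \<gamma> ?\<beta> (w s)"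
      using wnorm_mat_op_le[OF ovs gen pos \<beta>(1,2) Suc.prems(1)] unfolding \<beta>' c_def .
    also have "\<dots> \<le> ennreal c * (B * ennreal (c ^ k * (s ^ k / fact k)))"
      unfolding w_def c_def by (intro mult_left_mono Suc.IH \<beta> s) simp
    also have "\<dots> = (B * ennreal (c ^ Suc k)) * ennreal (s ^ k / fact k)"
    proof -
      have "ennreal c * ennreal (c ^ k * (s ^ k / fact k)) = ennreal (c ^ Suc k) * ennreal (s ^ k / fact k)"
        using c s by (simp add: mult.assoc flip: ennreal_mult)
      then show ?thesis
        by (simp only: mult.assoc mult.left_commute[of _ B])
    qed
    finally have "wnorm \<gamma> ?\<beta>' (mat_op \<gamma> A (w s)) \<le> (B * ennreal (c ^ Suc k)) * ennreal (s ^ k / fact k)" .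
    then show "indicator {..t} s * wnorm \<gamma> ?\<beta>' (mat_op \<gamma> A (w s))
        \<le> (B * ennreal (c ^ Suc k)) * (indicator {..t} s * ennreal (s ^ k / fact k))"
      by (simp split: split_indicator)
  qed
  also have "\<dots> = (B * ennreal (c ^ Suc k)) * (\<integral>\<^sup>+s. indicator {..t} s * ennreal (s ^ k / fact k) \<partial>?M)"
    by (rule nn_integral_cmult) measurable
  also have "\<dots> = B * ennreal (c ^ Suc k * (t ^ Suc k / fact (Suc k)))"
    unfolding nn_integral_power_lebesgue_on[OF Suc.prems(2)] mult.assoc
    using c Suc.prems(2) by (subst ennreal_mult) auto
  finally show ?case unfolding c_def .
qed

text \<open>
  Splitting \<open>[\<alpha>, \<beta>]\<close> into \<open>n\<close> equal steps gives the factor \<open>n powr (q * n)\<close>; the endpoint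
  \<open>\<beta> = b\<close>, which the Ovsjannikov property does not cover, is reached as a limit.
\<close>

lemma wnorm_volterra_power_le_K_term:
  fixes B :: real
  assumes ovs: "ovsjannikov \<gamma> a b q L Q" and gen: "generated_by \<gamma> a b Q A"
    and pos: "\<forall>x\<in>\<gamma>. \<forall>y\<in>\<gamma>. A x y \<ge> 0" and \<gamma>: "countable \<gamma>"
    and u: "\<And>y. y \<in> \<gamma> \<Longrightarrow> (\<lambda>t. u t y) \<in> borel_measurable (lebesgue_on {0..T})"
    and B: "\<And>t. t \<in> {0..T} \<Longrightarrow> wnorm \<gamma> \<alpha> (u t) \<le> ennreal B"
    and \<alpha>: "a \<le> \<alpha>" "\<alpha> < \<beta>" "\<beta> \<le> b" and t: "t \<in> {0..T}"
  shows "wnorm \<gamma> \<beta> ((volterra \<gamma> A T ^^ n) u t) \<le> ennreal B * ennreal (K_term q L T \<alpha> \<beta> n)"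
proof -
  let ?w = "(volterra \<gamma> A T ^^ n) u t"
  have L: "L > 0" using ovs by (simp add: ovsjannikov_def)
  have interior: "wnorm \<gamma> \<beta> ?w \<le> ennreal B * ennreal (K_term q L T \<alpha> \<beta> n)" if "\<alpha> < \<beta>" "\<beta> < b" for \<beta>
  \<comment> \<open>For n = 0 there is no step to divide by: the norm only decreases with the
    exponent, and the convention 0^0 = 1 makes \<open>K_term\<close> equal to 1.\<close>
  proof (cases "n = 0")
    case True
    have "wnorm \<gamma> \<beta> (u t) \<le> wnorm \<gamma> \<alpha> (u t)"
      using that by (intro wnorm_antimono_exponent) simp
    also have "\<dots> \<le> ennreal B" by (rule B[OF t])
    finally show ?thesis
      using True that by (simp add: K_term_0)
  next
    case False
    define h where "h = (\<beta> - \<alpha>) / real n"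
    have h: "h > 0" "\<alpha> + real n * h = \<beta>"
      using False that by (auto simp: h_def)
    have "wnorm \<gamma> \<beta> ?w \<le> ennreal B * ennreal ((L / h powr q) ^ n * (t ^ n / fact n))"
      using wnorm_volterra_power_le[OF ovs gen pos \<gamma> u B h(1) \<alpha>(1) _ t, where k = n] that
      unfolding h(2) by simp
    also have "\<dots> \<le> ennreal B * ennreal ((L / h powr q) ^ n * (T ^ n / fact n))"
      using t L h(1) by (intro mult_left_mono ennreal_leI divide_right_mono power_mono) auto
    also have "\<dots> = ennreal B * ennreal (K_term q L T \<alpha> \<beta> n)"
      using False that by (simp add: K_term_eq h_def)
    finally show ?thesis .
  qed
  show ?thesis
  proof (cases "\<beta> = b")
    case False
    then show ?thesis using interior \<alpha> by simp
  next
    case True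
    \<comment> \<open>For \<beta> < b the norm with exponent b is at most the norm with exponent
      \<beta>, which has the interior bound. That bound is continuous at b because b - \<alpha> >
      0.\<close>
    have "((\<lambda>\<beta>. ennreal B * ennreal (K_term q L T \<alpha> \<beta> n))
        \<longlongrightarrow> ennreal B * ennreal (K_term q L T \<alpha> b n)) (at_left b)"
      unfolding K_term_def using \<alpha> True
      by (intro ennreal_tendsto_cmult tendsto_ennrealI tendsto_intros) auto
    moreover have "\<forall>\<^sub>F \<beta> in at_left b. wnorm \<gamma> b ?w \<le> ennreal B * ennreal (K_term q L T \<alpha> \<beta> n)"
      unfolding eventually_at_left_field
    proof (intro exI conjI allI impI)
      show "\<alpha> < b" using \<alpha> True by simp
      fix \<beta> assume "\<alpha> < \<beta>" "\<beta> < b"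
      then show "wnorm \<gamma> b ?w \<le> ennreal B * ennreal (K_term q L T \<alpha> \<beta> n)"
        using interior wnorm_antimono_exponent[of \<beta> b \<gamma> ?w] by (meson less_imp_le order_trans)
    qed
    ultimately show ?thesis
      unfolding True by (rule tendsto_lowerbound) simp
  qed
qed

section \<open>Iterating an inequality u \<le> v + V u\<close>

lemma nn_integral_lebesgue_on_initial:
  fixes t :: real
  assumes "t \<in> {0..T}"
  shows "(\<integral>\<^sup>+s. f s \<partial>lebesgue_on {0..t}) = (\<integral>\<^sup>+s. indicator {..t} s * f s \<partial>lebesgue_on {0..T})"
proof -
  have "(\<integral>\<^sup>+s. f s \<partial>lebesgue_on {0..t}) = (\<integral>\<^sup>+s. f s * indicator {0..t} s \<partial>lebesgue)"
    by (rule nn_integral_restrict_space) auto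
  also have "\<dots> = (\<integral>\<^sup>+s. (indicator {..t} s * f s) * indicator {0..T} s \<partial>lebesgue)"
    using assms by (intro nn_integral_cong) (auto split: split_indicator)
  also have "\<dots> = (\<integral>\<^sup>+s. indicator {..t} s * f s \<partial>lebesgue_on {0..T})"
    by (rule nn_integral_restrict_space[symmetric]) auto
  finally show ?thesis .
qed

text \<open>For n = 0 the function is constant in time; for n > 0 the outermost integration runs
  over a larger interval. Evaluation at \<open>T\<close> therefore controls all times at
  once.\<close>

lemma volterra_power_mono_time:
  assumes "t \<le> t'"
  shows "(volterra \<gamma> A T ^^ n) (\<lambda>_. v) t x \<le> (volterra \<gamma> A T ^^ n) (\<lambda>_. v) t' x"
  using assms by (cases n) (auto intro: volterra_mono_time)

text \<open>The operator is monotone and additive, so it may be applied n times to both sides of the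
  inequality; measurability of the iterates is what additivity uses.\<close>

lemma volterra_power_le_add:
  assumes \<gamma>: "countable \<gamma>"
    and u: "\<And>y. y \<in> \<gamma> \<Longrightarrow> (\<lambda>t. u t y) \<in> borel_measurable (lebesgue_on {0..T})"
    and v: "\<And>y. y \<in> \<gamma> \<Longrightarrow> (\<lambda>t. v t y) \<in> borel_measurable (lebesgue_on {0..T})"
    and le: "\<And>t x. t \<in> {0..T} \<Longrightarrow> x \<in> \<gamma> \<Longrightarrow> u t x \<le> v t x + volterra \<gamma> A T u t x"
    and "t \<in> {0..T}" "x \<in> \<gamma>"
  shows "(volterra \<gamma> A T ^^ n) u t x \<le> (volterra \<gamma> A T ^^ n) v t x + (volterra \<gamma> A T ^^ Suc n) u t x"
  using assms(5,6)
proof (induction n arbitrary: t x)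
  case 0
  then show ?case using le by simp
next
  case (Suc n)
  let ?V = "volterra \<gamma> A T"
  have "(?V ^^ Suc n) u t x \<le> ?V (\<lambda>t x. (?V ^^ n) v t x + (?V ^^ Suc n) u t x) t x"
    unfolding funpow.simps(2)[of n] comp_def[of ?V] using Suc.IH by (intro volterra_mono) auto
  also have "\<dots> = (?V ^^ Suc n) v t x + (?V ^^ Suc (Suc n)) u t x"
    using borel_measurable_volterra_power[OF \<gamma> v] borel_measurable_volterra_power[OF \<gamma> u, where k = "Suc n"]
    by (simp add: volterra_add[OF \<gamma>] del: funpow.simps(2)) (simp add: comp_def)
  finally show ?case .
qed

lemma volterra_iterate_le:
  assumes \<gamma>: "countable \<gamma>"
    and u: "\<And>y. y \<in> \<gamma> \<Longrightarrow> (\<lambda>t. u t y) \<in> borel_measurable (lebesgue_on {0..T})"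
    and v: "\<And>y. y \<in> \<gamma> \<Longrightarrow> (\<lambda>t. v t y) \<in> borel_measurable (lebesgue_on {0..T})"
    and le: "\<And>t x. t \<in> {0..T} \<Longrightarrow> x \<in> \<gamma> \<Longrightarrow> u t x \<le> v t x + volterra \<gamma> A T u t x"
    and t: "t \<in> {0..T}" and x: "x \<in> \<gamma>"
  shows "u t x \<le> (\<Sum>n<N. (volterra \<gamma> A T ^^ n) v t x) + (volterra \<gamma> A T ^^ N) u t x"
proof (induction N)
  case (Suc N)
  note Suc
  also have "(\<Sum>n<N. (volterra \<gamma> A T ^^ n) v t x) + (volterra \<gamma> A T ^^ N) u t x
    \<le> (\<Sum>n<N. (volterra \<gamma> A T ^^ n) v t x)
        + ((volterra \<gamma> A T ^^ N) v t x + (volterra \<gamma> A T ^^ Suc N) u t x)"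
    by (intro add_left_mono volterra_power_le_add[OF \<gamma> u v le t x])
  finally show ?case
    by (simp add: add.assoc)
qed simp

section \<open>Bounding the supremum by the iterated series at the final time\<close>

theorem corollaryA7:
  fixes \<gamma> :: "(real ^ 'd) set"
    and T \<alpha>\<^sub>l \<alpha>\<^sub>u q L \<alpha> \<delta> :: real
    and Q :: "(real ^ 'd \<Rightarrow> real) \<Rightarrow> real ^ 'd \<Rightarrow> real"
    and A :: "real ^ 'd \<Rightarrow> real ^ 'd \<Rightarrow> real"
    and z :: "real ^ 'd \<Rightarrow> real"
    and g :: "real \<Rightarrow> real ^ 'd \<Rightarrow> real"
  assumes "locally_finite_set \<gamma>"
    and "T > 0"
    and "0 \<le> \<alpha>\<^sub>l" and "\<alpha>\<^sub>l < \<alpha>\<^sub>u"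
    and "q \<in> {0<..<1}"
    and "ovsjannikov \<gamma> \<alpha>\<^sub>l \<alpha>\<^sub>u q L Q"
    and "generated_by \<gamma> \<alpha>\<^sub>l \<alpha>\<^sub>u Q A"
    and "\<forall>x\<in>\<gamma>. \<forall>y\<in>\<gamma>. A x y \<ge> 0"
    and "\<alpha> \<in> {\<alpha>\<^sub>l..<\<alpha>\<^sub>u}"
    and "z \<in> l1 \<gamma> \<alpha>" and "\<forall>x\<in>\<gamma>. z x \<ge> 0"
    and "g \<in> measurable (lebesgue_on {0..T}) (l1_borel \<gamma> \<alpha>)"
    and "\<exists>B. \<forall>t\<in>{0..T}. l1_norm \<gamma> \<alpha> (g t) \<le> B"
    and "\<forall>t\<in>{0..T}. \<forall>x\<in>\<gamma>. g t x \<ge> 0"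
    and "\<delta> \<in> {\<alpha><..<\<alpha>\<^sub>u}"
    and "\<forall>t\<in>{0..T}. \<forall>x\<in>\<gamma>. g t x \<le> z x + l1_integral \<gamma> \<delta> (lebesgue_on {0..t}) (\<lambda>s. Q (g s)) x"
  shows "\<forall>\<beta>\<in>{\<alpha><..\<alpha>\<^sub>u}.
      summable (K_term q L T \<alpha> \<beta>) \<and>
      (\<forall>x\<in>\<gamma>. bdd_above ((\<lambda>t. g t x) ` {0..T})) \<and>
      (\<lambda>x. exp (- \<beta> * norm x) * (SUP t\<in>{0..T}. g t x)) summable_on \<gamma> \<and>
      (\<Sum>\<^sub>\<infinity>x\<in>\<gamma>. exp (- \<beta> * norm x) * (SUP t\<in>{0..T}. g t x))
        \<le> K_const q L T \<alpha> \<beta> * (\<Sum>\<^sub>\<infinity>x\<in>\<gamma>. exp (- \<alpha> * norm x) * z x)"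
proof -
  have q: "0 < q" "q < 1" using assms(5) by auto
  note ovs = assms(6) and gen = assms(7) and pos = assms(8)
  have L: "L > 0" using ovs by (simp add: ovsjannikov_def)
  have \<gamma>: "countable \<gamma>" using assms(1) by (rule locally_finite_set_countable)
  have \<alpha>: "\<alpha>\<^sub>l \<le> \<alpha>" "\<alpha> < \<alpha>\<^sub>u" using assms(9) by auto
  let ?V = "volterra \<gamma> A T"
  define Z where "Z = (\<Sum>\<^sub>\<infinity>x\<in>\<gamma>. exp (- \<alpha> * norm x) * z x)"
  define v where "v = (\<lambda>(t::real) x. ennreal (z x))"
  define G where "G = (\<lambda>t x. ennreal (g t x))"
  \<comment> \<open>The majorant is evaluated at \<open>T\<close>, so it is independent of
    \<open>t\<close>; values in [0, \<infinity>] make it meaningful before convergence is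
    known.\<close>
  define S where "S x = (\<Sum>n. (?V ^^ n) v T x)" for x
  have Z: "l1_norm \<gamma> \<alpha> z = Z" "Z \<ge> 0"
    unfolding l1_norm_def Z_def using assms(11) by (auto intro!: infsum_cong infsum_nonneg)
  obtain B where B: "\<And>t. t \<in> {0..T} \<Longrightarrow> l1_norm \<gamma> \<alpha> (g t) \<le> B" using assms(13) by blast
  \<comment> \<open>Membership is read off the measurability of \<open>g\<close>, whose target space
    is \<open>l1 \<gamma> \<alpha>\<close>.\<close>
  have g_l1: "g t \<in> l1 \<gamma> \<alpha>" if "t \<in> {0..T}" for t
    using measurable_space[OF assms(12), of t] that by (simp add: space_l1_borel)
  have vm: "(\<lambda>t. v t y) \<in> borel_measurable (lebesgue_on {0..T})" for y
    by (simp add: v_def)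
  have Gm: "(\<lambda>t. G t y) \<in> borel_measurable (lebesgue_on {0..T})" if "y \<in> \<gamma>" for y
    unfolding G_def
    using measurable_compose[OF assms(12) borel_measurable_l1_component[OF that]] by simp
  have vB: "wnorm \<gamma> \<alpha> (v t) \<le> ennreal Z" for t
    unfolding v_def using wnorm_real[OF assms(10)] assms(11) Z by simp
  have GB: "wnorm \<gamma> \<alpha> (G t) \<le> ennreal B" if "t \<in> {0..T}" for t
    unfolding G_def using wnorm_real[OF g_l1[OF that]] assms(14) that B by (simp add: ennreal_leI)
  have le: "G t x \<le> v t x + ?V G t x" if t: "t \<in> {0..T}" and x: "x \<in> \<gamma>" for t x
  proof -
    let ?I = "l1_integral \<gamma> \<delta> (lebesgue_on {0..t}) (\<lambda>s. Q (g s)) x"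
    have Qg: "mat_op \<gamma> A (G s) x = ennreal (Q (g s) x)" "0 \<le> Q (g s) x" if "s \<in> {0..t}" for s
      unfolding G_def using that t assms(14)
      by (auto intro!: mat_op_real[OF gen pos g_l1 assms(9) _ x])
    have "g t x \<le> z x + ?I" using assms(16) t x by blast
    \<comment> \<open>The sign of \<open>?I\<close> has not been established. Passing to
      \<open>max 0 ?I\<close> lets the sum split in \<open>ennreal\<close>, which sends negative
      reals to 0.\<close>
    then have "G t x \<le> ennreal (z x + max 0 ?I)"
      unfolding G_def by (intro ennreal_leI) simp
    also have "\<dots> = v t x + ennreal ?I"
      unfolding v_def using assms(11) x by (subst ennreal_plus) (auto simp: max_def ennreal_neg)
    also have "ennreal ?I \<le> (\<integral>\<^sup>+s. ennreal (Q (g s) x) \<partial>lebesgue_on {0..t})"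
      using Qg(2) by (intro l1_integral_le_nn_integral x) simp
    also have "\<dots> = (\<integral>\<^sup>+s. mat_op \<gamma> A (G s) x \<partial>lebesgue_on {0..t})"
      using Qg(1) by (intro nn_integral_cong) simp
    also have "\<dots> = ?V G t x"
      unfolding volterra_def by (rule nn_integral_lebesgue_on_initial[OF t])
    finally show ?thesis by (simp add: add_left_mono)
  qed
  have remainder: "(\<lambda>N. (?V ^^ N) G t x) \<longlonglongrightarrow> 0" if t: "t \<in> {0..T}" and x: "x \<in> \<gamma>" for t x
  proof -
    let ?e = "ennreal (exp (\<alpha>\<^sub>u * norm x))"
    \<comment> \<open>The largest exponent \<open>\<alpha>\<^sub>u\<close> is used, so the remainder
      is handled before any \<beta> is fixed; the bound tends to 0 as the terms of a convergent
      series do.\<close>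
    let ?b = "\<lambda>N. ?e * (ennreal B * ennreal (K_term q L T \<alpha> \<alpha>\<^sub>u N))"
    have bound: "(?V ^^ N) G t x \<le> ?b N" for N
    proof -
      have "(?V ^^ N) G t x \<le> ?e * wnorm \<gamma> \<alpha>\<^sub>u ((?V ^^ N) G t)"
        by (rule component_le_wnorm[OF x])
      also have "\<dots> \<le> ?b N"
        by (intro mult_left_mono wnorm_volterra_power_le_K_term[OF ovs gen pos \<gamma> Gm GB \<alpha> order_refl t]) simp_all
      finally show ?thesis .
    qed
    have "K_term q L T \<alpha> \<alpha>\<^sub>u \<longlonglongrightarrow> 0"
      using summable_K_term[of q L T \<alpha> \<alpha>\<^sub>u] q L assms(2) \<alpha> by (intro summable_LIMSEQ_zero) simp
    then have "(\<lambda>N. ennreal (K_term q L T \<alpha> \<alpha>\<^sub>u N)) \<longlonglongrightarrow> ennreal 0"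
      by (rule tendsto_ennrealI)
    then have "?b \<longlonglongrightarrow> ?e * (ennreal B * ennreal 0)"
      by (intro ennreal_tendsto_cmult) simp_all
    then have b0: "?b \<longlonglongrightarrow> 0" by simp
    show ?thesis
      by (rule tendsto_sandwich[OF _ _ tendsto_const b0]) (simp_all only: bound zero_le eventually_True)
  qed
  \<comment> \<open>For every N the partial sum at \<open>t\<close> is at most \<open>S x\<close>;
    letting N tend to infinity removes the remainder.\<close>
  have G_le_S: "G t x \<le> S x" if t: "t \<in> {0..T}" and x: "x \<in> \<gamma>" for t x
  proof -
    have "G t x \<le> S x + (?V ^^ N) G t x" for N
    proof -
      have "G t x \<le> (\<Sum>n<N. (?V ^^ n) v t x) + (?V ^^ N) G t x"
        by (rule volterra_iterate_le[OF \<gamma> Gm vm le t x])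
      also have "(\<Sum>n<N. (?V ^^ n) v t x) \<le> (\<Sum>n<N. (?V ^^ n) v T x)"
        unfolding v_def using t by (intro sum_mono volterra_power_mono_time) simp
      also have "\<dots> \<le> S x"
        unfolding S_def by (rule sum_le_suminf) auto
      finally show ?thesis by (simp add: add_right_mono)
    qed
    moreover have "(\<lambda>N. S x + (?V ^^ N) G t x) \<longlonglongrightarrow> S x + 0"
      by (intro tendsto_add tendsto_const remainder t x)
    ultimately have "G t x \<le> S x + 0"
      by (intro LIMSEQ_le_const) auto
    then show ?thesis by simp
  qed
  show ?thesis
  proof
    fix \<beta> assume "\<beta> \<in> {\<alpha><..\<alpha>\<^sub>u}"
    then have \<beta>: "\<alpha> < \<beta>" "\<beta> \<le> \<alpha>\<^sub>u" by auto
    let ?K = "K_term q L T \<alpha> \<beta>"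
    have sK: "summable ?K"
      using summable_K_term[of q L T \<alpha> \<beta>] q L assms(2) \<beta> by simp
    have K0: "0 \<le> ?K n" for n
      using L assms(2) by (intro K_term_nonneg) auto
    \<comment> \<open>The norm is countably additive on nonnegative functions, so the bounds for the
      iterates of the constant-in-time \<open>v\<close>, of norm at most \<open>Z\<close>, add up to
      \<open>K_const\<close> times \<open>Z\<close>.\<close>
    have "wnorm \<gamma> \<beta> S = (\<Sum>n. wnorm \<gamma> \<beta> ((?V ^^ n) v T))"
      unfolding S_def by (rule wnorm_suminf)
    also have "\<dots> \<le> (\<Sum>n. ennreal Z * ennreal (?K n))"
      using assms(2) by (intro suminf_le wnorm_volterra_power_le_K_term[OF ovs gen pos \<gamma> vm vB \<alpha>(1) \<beta>]) auto
    also have "\<dots> = ennreal Z * ennreal (K_const q L T \<alpha> \<beta>)"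
      unfolding K_const_def using K0 sK by (simp add: suminf_ennreal2)
    also have "\<dots> = ennreal (K_const q L T \<alpha> \<beta> * Z)"
      unfolding K_const_def using Z K0 sK by (subst mult.commute) (simp add: ennreal_mult suminf_nonneg)
    finally have S_le: "wnorm \<gamma> \<beta> S \<le> ennreal (K_const q L T \<alpha> \<beta> * Z)" .
    have S_fin: "S x < top" if "x \<in> \<gamma>" for x
    proof -
      have "S x \<le> ennreal (exp (\<beta> * norm x)) * wnorm \<gamma> \<beta> S"
        by (rule component_le_wnorm[OF that])
      also have "\<dots> < top"
        using S_le by (auto simp: ennreal_mult_less_top intro: le_less_trans)
      finally show ?thesis .
    qed
    have g_le: "g t x \<le> enn2real (S x)" if "t \<in> {0..T}" "x \<in> \<gamma>" for t x
      using enn2real_mono[OF G_le_S[OF that] S_fin[OF that(2)]] assms(14) that by (simp add: G_def)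
    have bdd: "bdd_above ((\<lambda>t. g t x) ` {0..T})" if "x \<in> \<gamma>" for x
      using g_le that by (intro bdd_aboveI2)
    let ?F = "\<lambda>x. exp (- \<beta> * norm x) * (SUP t\<in>{0..T}. g t x)"
    \<comment> \<open>The value at time 0, an element of [0, T] since T > 0, is a nonnegative lower
      bound for the supremum.\<close>
    have sup0: "0 \<le> (SUP t\<in>{0..T}. g t x)" if "x \<in> \<gamma>" for x
      using assms(2,14) that by (intro cSUP_upper2[OF bdd[OF that], of 0]) auto
    have supS: "(SUP t\<in>{0..T}. g t x) \<le> enn2real (S x)" if "x \<in> \<gamma>" for x
      using assms(2) g_le that by (intro cSUP_least) auto
    have "(\<integral>\<^sup>+x. ennreal (?F x) \<partial>count_space \<gamma>) \<le> wnorm \<gamma> \<beta> S"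
      unfolding wnorm_def
    proof (intro nn_integral_mono)
      fix x assume "x \<in> space (count_space \<gamma>)"
      then have x: "x \<in> \<gamma>" by simp
      have "ennreal (?F x) = ennreal (exp (- \<beta> * norm x)) * ennreal (SUP t\<in>{0..T}. g t x)"
        using sup0[OF x] by (intro ennreal_mult) auto
      also have "\<dots> \<le> ennreal (exp (- \<beta> * norm x)) * ennreal (enn2real (S x))"
        by (intro mult_left_mono ennreal_leI supS x) simp
      finally show "ennreal (?F x) \<le> ennreal (exp (- \<beta> * norm x)) * S x"
        using S_fin[OF x] by simp
    qed
    also note S_le
    finally have F_le: "(\<integral>\<^sup>+x. ennreal (?F x) \<partial>count_space \<gamma>) \<le> ennreal (K_const q L T \<alpha> \<beta> * Z)" .
    have F0: "0 \<le> ?F x" if "x \<in> \<gamma>" for x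
      using sup0[OF that] by simp
    have F_sum: "?F summable_on \<gamma>"
      using F_le by (intro summable_on_of_nn_integral_count_space F0) (auto intro: le_less_trans)
    have "ennreal (infsum ?F \<gamma>) \<le> ennreal (K_const q L T \<alpha> \<beta> * Z)"
      using F_le nn_integral_count_space_eq_infsum[OF F0 F_sum] by simp
    moreover have "0 \<le> K_const q L T \<alpha> \<beta> * Z"
      unfolding K_const_def using Z K0 sK by (simp add: suminf_nonneg)
    ultimately have "infsum ?F \<gamma> \<le> K_const q L T \<alpha> \<beta> * Z"
      by (simp add: ennreal_le_iff)
    then show "summable ?K \<and> (\<forall>x\<in>\<gamma>. bdd_above ((\<lambda>t. g t x) ` {0..T})) \<and> ?F summable_on \<gamma> \<and>
        infsum ?F \<gamma> \<le> K_const q L T \<alpha> \<beta> * (\<Sum>\<^sub>\<infinity>x\<in>\<gamma>. exp (- \<alpha> * norm x) * z x)"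
      unfolding Z_def[symmetric] using sK bdd F_sum by (intro conjI ballI)
  qed
qed

end
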